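(* The set of $f\in\mathrm{Diff}^1_P([0,1])$ such that for no integer $k\ge 2$ does there exist $h\in\mathrm{Diff}^1_+([0,1])$ with $hfh^{-1}=f^k$ is residual in $\mathrm{Diff}^1_P([0,1])$ (i.e. it contains a countable intersection of open dense subsets of $\mathrm{Diff}^1_P([0,1])$).
   Context: $\mathrm{Diff}^1_+([0,1])$ is the group of orientation-preserving $C^1$ diffeomorphisms of $[0,1]$ (under composition; $f^k$ is the $k$-th iterate), with the $C^1$ topology given by the distance $\|f-g\|_1=\max_{x\in[0,1]}|Df(x)-Dg(x)|$. $\mathrm{Diff}^1_P([0,1])$ is the (closed) subspace of those $f\in\mathrm{Diff}^1_+([0,1])$ all of whose fixed points $a\in[0,1]$ (including $0$ and $1$) are parabolic, i.e. $Df(a)=1$, with the induced topology. *)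

theory Defs
  imports "HOL-Analysis.Analysis"
begin

text \<open>
  A self-map of \<open>[0,1]\<close> is represented by a function \<open>real \<Rightarrow> real\<close> that is the identity outside
  \<open>[0,1]\<close>. The representation is unique, and equality, composition, inverse and iteration of
  self-maps are then \<open>=\<close>, \<open>\<circ>\<close>, \<open>inv\<close> and \<open>^^\<close>. All derivatives are taken within \<open>[0,1]\<close>,
  so they are one-sided at the end points.
\<close>

definition D01 :: "(real \<Rightarrow> real) \<Rightarrow> real \<Rightarrow> real" where
  "D01 f x = vector_derivative f (at x within {0..1})"

definition C1_on_01 :: "(real \<Rightarrow> real) \<Rightarrow> bool" where
  "C1_on_01 f \<longleftrightarrow> f differentiable_on {0..1} \<and> continuous_on {0..1} (D01 f)"

definition Diff1 :: "(real \<Rightarrow> real) set" where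
  "Diff1 = {f. bij_betw f {0..1} {0..1} \<and> (\<forall>x. x \<notin> {0..1} \<longrightarrow> f x = x)
     \<and> strict_mono_on {0..1} f \<and> C1_on_01 f \<and> C1_on_01 (inv f)}"

text \<open>
  The supremum is a maximum, since the derivatives are continuous on \<open>[0,1]\<close>. The value \<open>0\<close>
  outside \<open>Diff1\<close> is irrelevant to the topology; it is there because the locale
  \<open>Metric_space\<close> asks for nonnegativity and symmetry on the whole type.
\<close>

definition C1_dist :: "(real \<Rightarrow> real) \<Rightarrow> (real \<Rightarrow> real) \<Rightarrow> real" where
  "C1_dist f g =
     (if f \<in> Diff1 \<and> g \<in> Diff1 then SUP x\<in>{0..1}. \<bar>D01 f x - D01 g x\<bar> else 0)"

definition Diff1_topology :: "(real \<Rightarrow> real) topology" where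
  "Diff1_topology = Metric_space.mtopology Diff1 C1_dist"

definition Diff1P :: "(real \<Rightarrow> real) set" where
  "Diff1P = {f \<in> Diff1. \<forall>a\<in>{0..1}. f a = a \<longrightarrow> D01 f a = 1}"

definition Diff1P_topology :: "(real \<Rightarrow> real) topology" where
  "Diff1P_topology = subtopology Diff1_topology Diff1P"

definition residual_in :: "'a topology \<Rightarrow> 'a set \<Rightarrow> bool" where
  "residual_in X S \<longleftrightarrow> S \<subseteq> topspace X \<and>
     (\<exists>U :: nat \<Rightarrow> 'a set. (\<forall>n. openin X (U n) \<and> X closure_of (U n) = topspace X)
        \<and> (\<Inter>n. U n) \<subseteq> S)"

lemma Diff1_bij:
  assumes "f \<in> Diff1"
  shows "bij f"
proof -
  have 1: "bij_betw f {0..1} {0..1}" and 2: "\<And>x. x \<notin> {0..1} \<Longrightarrow> f x = x"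
    using assms by (auto simp: Diff1_def)
  have "bij_betw f (- {0..1}) (- {0..1}) = bij_betw id (- {0..1}) (- {0..1::real})"
    by (rule bij_betw_cong) (use 2 in auto)
  then have "bij_betw f (- {0..1}) (- {0..1})"
    by simp
  with 1 have "bij_betw f ({0..1} \<union> - {0..1}) ({0..1} \<union> - {0..1})"
    by (rule bij_betw_combine) auto
  then show ?thesis
    by (simp add: Un_commute)
qed

lemma Diff1_has_derivative:
  assumes "f \<in> Diff1" "x \<in> {0..1}"
  shows "(f has_vector_derivative D01 f x) (at x within {0..1})"
  using assms unfolding Diff1_def C1_on_01_def D01_def differentiable_on_def
  by (auto simp: vector_derivative_works)

lemma Diff1_0:
  assumes "f \<in> Diff1"
  shows "f 0 = 0"
proof -
  have b: "bij_betw f {0..1} {0..1}" and m: "strict_mono_on {0..1} f"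
    using assms by (auto simp: Diff1_def)
  have "0 \<in> f ` {0..1}" using b by (simp add: bij_betw_def)
  then obtain x where x: "x \<in> {0..1}" "f x = 0" by (metis imageE)
  have "f 0 \<in> {0..1}" using bij_betwE[OF b] by simp
  moreover have "f 0 < f x" if "x \<noteq> 0"
    using strict_mono_onD[OF m, of 0 x] x that by auto
  ultimately show ?thesis using x by force
qed

lemma Diff1_bdd_above:
  assumes "f \<in> Diff1" "g \<in> Diff1"
  shows "bdd_above ((\<lambda>x. \<bar>D01 f x - D01 g x\<bar>) ` {0..1})"
proof -
  have "continuous_on {0..1} (\<lambda>x. \<bar>D01 f x - D01 g x\<bar>)"
    using assms by (intro continuous_intros) (auto simp: Diff1_def C1_on_01_def)
  then show ?thesis
    by (intro bounded_imp_bdd_above compact_imp_bounded compact_continuous_image) auto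
qed

lemma Diff1_eqI:
  assumes f: "f \<in> Diff1" and g: "g \<in> Diff1" and D: "\<And>x. x \<in> {0..1} \<Longrightarrow> D01 f x = D01 g x"
  shows "f = g"
proof
  fix x
  show "f x = g x"
  proof (cases "x \<in> {0..1}")
    case True
    have "((\<lambda>x. f x - g x) has_vector_derivative 0) (at y within {0..1})" if "y \<in> {0..1}" for y
      using has_vector_derivative_diff
        [OF Diff1_has_derivative[OF f that] Diff1_has_derivative[OF g that]] D[OF that] by simp
    then obtain c where c: "\<And>y. y \<in> {0..1} \<Longrightarrow> f y - g y = c"
      using has_vector_derivative_zero_constant[of "{0..1}" "\<lambda>x. f x - g x"] by auto
    from c[of 0] have "c = 0" using Diff1_0[OF f] Diff1_0[OF g] by simp
    then show ?thesis using c[OF True] by simp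
  next
    case False
    then show ?thesis using f g by (simp add: Diff1_def)
  qed
qed

lemma Metric_space_Diff1: "Metric_space Diff1 C1_dist"
proof
  have up: "\<bar>D01 f x - D01 g x\<bar> \<le> C1_dist f g"
    if "f \<in> Diff1" "g \<in> Diff1" "x \<in> {0..1}" for f g x
    using that cSUP_upper[OF that(3) Diff1_bdd_above[OF that(1,2)]] by (simp add: C1_dist_def)
  show nn: "0 \<le> C1_dist f g" for f g
  proof (cases "f \<in> Diff1 \<and> g \<in> Diff1")
    case True
    then show ?thesis using up[of f g 0] by simp
  qed (auto simp: C1_dist_def)
  show "C1_dist f g = C1_dist g f" for f g
    by (auto simp: C1_dist_def abs_minus_commute)
  show "C1_dist f g = 0 \<longleftrightarrow> f = g" if "f \<in> Diff1" "g \<in> Diff1" for f g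
  proof
    assume "C1_dist f g = 0"
    then show "f = g"
      using up[OF that] by (intro Diff1_eqI[OF that]) fastforce
  qed (simp add: C1_dist_def)
  show "C1_dist f h \<le> C1_dist f g + C1_dist g h"
    if "f \<in> Diff1" "g \<in> Diff1" "h \<in> Diff1" for f g h
  proof -
    have "(SUP x\<in>{0..1}. \<bar>D01 f x - D01 h x\<bar>) \<le> C1_dist f g + C1_dist g h"
    proof (rule cSUP_least)
      fix x :: real assume "x \<in> {0..1}"
      then show "\<bar>D01 f x - D01 h x\<bar> \<le> C1_dist f g + C1_dist g h"
        using up[of f g x] up[of g h x] that by linarith
    qed simp
    then show ?thesis using that by (simp add: C1_dist_def)
  qed
qed

lemma topspace_Diff1_topology: "topspace Diff1_topology = Diff1"
  by (simp add: Diff1_topology_def Metric_space.topspace_mtopology[OF Metric_space_Diff1])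

lemma topspace_Diff1P_topology: "topspace Diff1P_topology = Diff1P"
  by (auto simp: Diff1P_topology_def topspace_Diff1_topology Diff1P_def)

end

theory Submission
  imports Defs
begin

text \<open>
  Write \<open>\<Delta> y = f y - y\<close> for the displacement and \<open>\<delta> y = \<Delta> y / y\<close> for the displacement
  relative to the end point \<open>0\<close>. Suppose \<open>h \<circ> f \<circ> inv h = f ^^ k\<close> with \<open>k \<ge> 2\<close>, and put
  \<open>y = inv h x\<close> for a small \<open>x\<close>. The mean value theorem gives
  \<open>(f ^^ k) x - x = h (f y) - h y = h' \<xi> * \<Delta> y\<close> and \<open>x = h y = h' \<zeta> * y\<close> with \<open>\<xi>\<close> and \<open>\<zeta>\<close>
  close to \<open>0\<close>. Since \<open>f\<close> is parabolic at \<open>0\<close>, successive displacements along an orbit near \<open>0\<close>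
  are almost equal, so \<open>(f ^^ k) x - x\<close> is about \<open>k * \<Delta> x\<close>. The factor \<open>h' 0\<close> cancels, and
  \<open>\<delta> (inv h x)\<close> is about \<open>k * \<delta> x\<close>, whereas \<open>inv h x\<close> is about \<open>x / h' 0\<close>. Thus at every
  small scale \<open>x\<close>, moving by a bounded factor to \<open>inv h x\<close> makes \<open>\<bar>\<delta>\<bar>\<close> grow by a factor of
  at least about \<open>2\<close>.

  This is impossible for an \<open>f\<close> with arbitrarily small scales \<open>x\<close> at which \<open>\<bar>\<delta> x\<bar>\<close> is
  positive and not exceeded by more than a factor \<open>3/2\<close> on \<open>(0, n * x]\<close>, for \<open>n\<close> as large as
  desired: as soon as \<open>n * h' 0 \<ge> 2\<close>, the point \<open>inv h x\<close> lies in that window. Having such a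
  scale for a given \<open>n\<close> is the condition \<open>peak_set n\<close>, and \<open>peaks_obstruct_conjugacy\<close> is the
  argument above.

  The set \<open>peak_set n\<close> is open because the \<open>C\<^sup>1\<close> distance bounds the change of \<open>\<delta>\<close>
  uniformly, also near \<open>0\<close>. It is dense (\<open>peak_set_dense\<close>) because near \<open>0\<close> a parabolic \<open>f\<close> is
  \<open>C\<^sup>1\<close>-close to the identity, so that there is room for a change of \<open>\<Delta>\<close> on a short interval
  \<open>[0, a]\<close> that makes \<open>\<delta>\<close> nearly constant on the window. The delicate point is to keep all
  fixed points parabolic. For this, \<open>\<Delta>\<close> is first arranged to have one sign on \<open>[0, a]\<close>, and
  then a function of the same sign is added to it: the only fixed points left in
  \<open>[0, a]\<close> are then \<open>0\<close> and possibly \<open>a\<close>, where the derivative is controlled.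
\<close>

section \<open>Derivatives of elements of Diff1\<close>

lemma Diff1_has_real_derivative:
  assumes "f \<in> Diff1" "x \<in> {0..1}"
  shows "(f has_real_derivative D01 f x) (at x within {0..1})"
  using Diff1_has_derivative[OF assms] by (simp add: has_real_derivative_iff_has_vector_derivative)

lemma D01_eqI:
  assumes "(f has_real_derivative d) (at x within {0..1})" "x \<in> {0..1}"
  shows "D01 f x = d"
  unfolding D01_def
  by (rule vector_derivative_within_closed_interval)
    (use assms in \<open>auto simp: has_real_derivative_iff_has_vector_derivative\<close>)

lemma Diff1_continuous_on_D01: "f \<in> Diff1 \<Longrightarrow> continuous_on {0..1} (D01 f)"
  by (simp add: Diff1_def C1_on_01_def)

lemma Diff1_less:
  assumes "f \<in> Diff1" "0 \<le> x" "x < y" "y \<le> 1"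
  shows "f x < f y"
  using assms strict_mono_onD[of "{0..1}" f x y] by (auto simp: Diff1_def)

lemma Diff1_le:
  assumes "f \<in> Diff1" "0 \<le> x" "x \<le> y" "y \<le> 1"
  shows "f x \<le> f y"
  using Diff1_less[OF assms(1), of x y] assms by (cases "x = y") auto

lemma Diff1_mem:
  assumes "f \<in> Diff1" "x \<in> {0..1}"
  shows "f x \<in> {0..1}"
  using assms bij_betwE[of f "{0..1}" "{0..1}"] by (auto simp: Diff1_def)

lemma Diff1_1:
  assumes "f \<in> Diff1"
  shows "f 1 = 1"
proof -
  have "1 \<in> f ` {0..1}" using assms by (simp add: bij_betw_def Diff1_def)
  then obtain x where x: "x \<in> {0..1}" "f x = 1" by (metis imageE)
  then show ?thesis
    using Diff1_le[OF assms, of x 1] Diff1_mem[OF assms, of 1] by auto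
qed

lemma Diff1_inv_mem:
  assumes "f \<in> Diff1" "x \<in> {0..1}"
  shows "inv f x \<in> {0..1}"
proof -
  have "x \<in> f ` {0..1}" using assms by (simp add: bij_betw_def Diff1_def)
  then obtain y where "y \<in> {0..1}" "f y = x" by (metis imageE)
  then show ?thesis
    using Diff1_bij[OF assms(1)] by (metis bij_inv_eq_iff)
qed

lemma Diff1_has_real_derivative_inv:
  assumes "f \<in> Diff1" "y \<in> {0..1}"
  shows "(inv f has_real_derivative D01 (inv f) y) (at y within {0..1})"
  using assms unfolding Diff1_def C1_on_01_def D01_def differentiable_on_def
  by (auto simp: vector_derivative_works has_real_derivative_iff_has_vector_derivative)

text \<open>
  The difference quotients are positive, so the derivative is nonnegative; it does not vanish
  because the inverse is differentiable as well.
\<close>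

lemma Diff1_D01_pos:
  assumes f: "f \<in> Diff1" and x: "x \<in> {0..1}"
  shows "0 < D01 f x"
proof -
  have df: "(f has_real_derivative D01 f x) (at x within {0..1})"
    by (rule Diff1_has_real_derivative[OF f x])
  have "f ` {0..1} \<subseteq> {0..1}" using Diff1_mem[OF f] by auto
  then have "(inv f has_real_derivative D01 (inv f) (f x)) (at (f x) within f ` {0..1})"
    by (rule DERIV_subset[OF Diff1_has_real_derivative_inv[OF f Diff1_mem[OF f x]]])
  from DERIV_image_chain[OF this df]
  have "((inv f \<circ> f) has_real_derivative D01 (inv f) (f x) * D01 f x) (at x within {0..1})" .
  moreover have "inv f \<circ> f = (\<lambda>x. x)"
    using Diff1_bij[OF f] by (auto simp: fun_eq_iff bij_is_inj)
  ultimately have "((\<lambda>x. x) has_real_derivative D01 (inv f) (f x) * D01 f x) (at x within {0..1})"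
    by simp
  from D01_eqI[OF this x] D01_eqI[OF DERIV_ident x] have "D01 f x \<noteq> 0" by auto
  moreover have "0 \<le> D01 f x"
  proof (rule tendsto_lowerbound)
    show "((\<lambda>y. (f y - f x) / (y - x)) \<longlongrightarrow> D01 f x) (at x within {0..1})"
      using df by (simp add: has_field_derivative_iff)
    show "\<forall>\<^sub>F y in at x within {0..1}. 0 \<le> (f y - f x) / (y - x)"
      unfolding eventually_at_filter
    proof (intro always_eventually allI impI)
      fix y assume "y \<noteq> x" "y \<in> {0..1}"
      then show "0 \<le> (f y - f x) / (y - x)"
        using Diff1_less[OF f, of x y] Diff1_less[OF f, of y x] x
        by (cases "x < y") (auto simp: divide_nonpos_nonpos)
    qed
    show "at x within {0..1} \<noteq> bot"
      using x by (simp add: at_within_Icc_at_right trivial_limit_within islimpt_Icc)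
  qed
  ultimately show ?thesis by simp
qed

lemma Diff1_mean_value:
  assumes f: "f \<in> Diff1" and "0 \<le> u" "0 \<le> v" "u \<le> r" "v \<le> r" "r \<le> 1"
  obtains z where "0 \<le> z" "z \<le> r" "f v - f u = D01 f z * (v - u)"
proof -
  have *: "\<exists>z\<in>{0..r}. f v - f u = D01 f z * (v - u)"
    if "0 \<le> u" "u < v" "v \<le> r" for u v
  proof -
    have "\<exists>z\<in>{u<..<v}. f v - f u = (\<lambda>z h. D01 f z * h) z (v - u)"
    proof (rule mvt_simple[OF \<open>u < v\<close>])
      fix z assume "u \<le> z" "z \<le> v"
      then have "(f has_real_derivative D01 f z) (at z within {u..v})"
        using that assms
        by (intro DERIV_subset[OF Diff1_has_real_derivative[OF f]]) auto
      then show "(f has_derivative (\<lambda>h. D01 f z * h)) (at z within {u..v})"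
        by (simp add: has_field_derivative_def)
    qed
    then show ?thesis using that by fastforce
  qed
  consider "u < v" | "v < u" | "u = v" by linarith
  then show ?thesis
  proof cases
    case 1
    then show ?thesis using *[of u v] assms that by auto
  next
    case 2
    then obtain z where "z \<in> {0..r}" "f u - f v = D01 f z * (u - v)" using *[of v u] assms by auto
    then show ?thesis using that[of z] by (auto simp: algebra_simps)
  next
    case 3
    then show ?thesis using that[of 0] assms by auto
  qed
qed

lemma Diff1_D01_near_0:
  assumes f: "f \<in> Diff1" and "0 < e"
  obtains r where "0 < r" "r \<le> 1" "\<And>z. 0 \<le> z \<Longrightarrow> z \<le> r \<Longrightarrow> \<bar>D01 f z - D01 f 0\<bar> \<le> e"
proof -
  from Diff1_continuous_on_D01[OF f] \<open>0 < e\<close>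
  obtain d where d: "d > 0" "\<And>z. z \<in> {0..1} \<Longrightarrow> dist z 0 < d \<Longrightarrow> dist (D01 f z) (D01 f 0) < e"
    unfolding continuous_on_iff by (metis atLeastAtMost_iff order_refl zero_le_one)
  show ?thesis
    by (rule that[of "min (d/2) 1"]) (use d in \<open>auto simp: dist_real_def intro!: less_imp_le\<close>)
qed

text \<open>
  With \<open>u = 0\<close> this bounds the displacement relative to \<open>0\<close>; with \<open>v = f u\<close> it says that
  consecutive displacements along an orbit near a parabolic end point are almost equal.
\<close>

lemma Diff1_displacement_lipschitz:
  assumes f: "f \<in> Diff1" and r: "r \<le> 1" and D: "\<And>z. 0 \<le> z \<Longrightarrow> z \<le> r \<Longrightarrow> \<bar>D01 f z - 1\<bar> \<le> e"
    and "0 \<le> u" "u \<le> r" "0 \<le> v" "v \<le> r"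
  shows "\<bar>(f v - v) - (f u - u)\<bar> \<le> e * \<bar>v - u\<bar>"
proof -
  obtain z where z: "0 \<le> z" "z \<le> r" "f v - f u = D01 f z * (v - u)"
    using Diff1_mean_value[OF f, of u v r] assms by metis
  then have "(f v - v) - (f u - u) = (D01 f z - 1) * (v - u)" by (simp add: algebra_simps)
  then have "\<bar>(f v - v) - (f u - u)\<bar> = \<bar>D01 f z - 1\<bar> * \<bar>v - u\<bar>" by (simp add: abs_mult)
  also have "\<dots> \<le> e * \<bar>v - u\<bar>" using D[OF z(1,2)] by (intro mult_right_mono) auto
  finally show ?thesis .
qed

section \<open>Constructing elements of Diff1\<close>

text \<open>
  The difference quotients of \<open>g\<close> at \<open>f x\<close> are the reciprocals of those of \<open>f\<close> at \<open>x\<close>. Working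
  within sets makes this cover the one-sided derivatives at the end points.
\<close>

lemma has_real_derivative_inverse_within:
  fixes f g :: "real \<Rightarrow> real"
  assumes df: "(f has_real_derivative d) (at x within S)" and "d \<noteq> 0"
    and cont: "(g \<longlongrightarrow> x) (at (f x) within T)"
    and gT: "\<And>y. y \<in> T \<Longrightarrow> g y \<in> S \<and> f (g y) = y" and gx: "g (f x) = x"
  shows "(g has_real_derivative inverse d) (at (f x) within T)"
  unfolding has_field_derivative_iff
proof -
  have lim: "filterlim g (at x within S) (at (f x) within T)"
    unfolding filterlim_at using cont gT
    by (auto simp: eventually_at_filter intro!: always_eventually)
  have "((\<lambda>u. (f u - f x) / (u - x)) \<longlongrightarrow> d) (at x within S)"
    using df by (simp add: has_field_derivative_iff)
  then have "((\<lambda>u. inverse ((f u - f x) / (u - x))) \<longlongrightarrow> inverse d) (at x within S)"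
    using \<open>d \<noteq> 0\<close> by (rule tendsto_inverse)
  from filterlim_compose[OF this lim]
  have "((\<lambda>y. inverse ((f (g y) - f x) / (g y - x))) \<longlongrightarrow> inverse d) (at (f x) within T)" .
  then show "((\<lambda>y. (g y - g (f x)) / (y - f x)) \<longlongrightarrow> inverse d) (at (f x) within T)"
    by (rule Lim_transform_eventually)
      (auto simp: eventually_at_filter gT gx intro!: always_eventually)
qed

text \<open>
  A positive continuous derivative suffices: the inverse is then automatically \<open>C\<^sup>1\<close>.
\<close>

lemma Diff1I:
  assumes df: "\<And>x. x \<in> {0..1} \<Longrightarrow> (f has_real_derivative f' x) (at x within {0..1})"
    and cf': "continuous_on {0..1} f'" and pos: "\<And>x. x \<in> {0..1} \<Longrightarrow> 0 < f' x"
    and ends: "f 0 = 0" "f 1 = 1" and out: "\<And>x. x \<notin> {0..1} \<Longrightarrow> f x = x"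
  shows "f \<in> Diff1"
proof -
  have cf: "continuous_on {0..1} f"
    using df by (meson DERIV_continuous_on)
  have less: "f u < f v" if "0 \<le> u" "u < v" "v \<le> 1" for u v
  proof -
    have "\<exists>z\<in>{u<..<v}. f v - f u = (\<lambda>z h. f' z * h) z (v - u)"
    proof (rule mvt_simple[OF \<open>u < v\<close>])
      fix z assume "u \<le> z" "z \<le> v"
      then have "(f has_real_derivative f' z) (at z within {u..v})"
        using that by (intro DERIV_subset[OF df]) auto
      then show "(f has_derivative (\<lambda>h. f' z * h)) (at z within {u..v})"
        by (simp add: has_field_derivative_def)
    qed
    then obtain z where "z \<in> {u<..<v}" "f v - f u = f' z * (v - u)" by auto
    moreover have "f' z * (v - u) > 0"
      using pos[of z] \<open>z \<in> {u<..<v}\<close> that by (intro mult_pos_pos) auto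
    ultimately show ?thesis by linarith
  qed
  have mono: "strict_mono_on {0..1} f" using less by (auto simp: strict_mono_on_def)
  then have inj: "inj_on f {0..1}" by (rule strict_mono_on_imp_inj_on)
  have img: "f ` {0..1} = {0..1}"
  proof
    show "f ` {0..1} \<subseteq> {0..1}"
    proof
      fix y assume "y \<in> f ` {0..1}"
      then obtain x where x: "x \<in> {0..1}" "y = f x" by auto
      have "f 0 \<le> f x" using less[of 0 x] x by (cases "x = 0") auto
      moreover have "f x \<le> f 1" using less[of x 1] x by (cases "x = 1") auto
      ultimately show "y \<in> {0..1}" using x ends by simp
    qed
    show "{0..1} \<subseteq> f ` {0..1}"
    proof
      fix y :: real assume "y \<in> {0..1}"
      then obtain x where "0 \<le> x" "x \<le> 1" "f x = y"
        using IVT'[of f 0 y 1] cf ends by auto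
      then show "y \<in> f ` {0..1}" by auto
    qed
  qed
  have bij: "bij_betw f {0..1} {0..1}" using inj img by (simp add: bij_betw_def)
  have "inj f"
  proof (rule injI)
    fix x y assume "f x = f y"
    then show "x = y"
      using inj img out by (metis image_eqI inj_onD)
  qed
  then have inv_f: "inv f (f x) = x" for x by simp
  have inv_mem: "inv f y \<in> {0..1} \<and> f (inv f y) = y" if "y \<in> {0..1}" for y
  proof -
    from that obtain x where "x \<in> {0..1}" "f x = y" using img by (metis imageE)
    then show ?thesis using inv_f by auto
  qed
  have cinv: "continuous_on {0..1} (inv f)"
    using continuous_on_inv[OF cf, of "inv f"] inv_f by (simp add: img)
  have dinv: "(inv f has_real_derivative inverse (f' (inv f y))) (at y within {0..1})"
    if y: "y \<in> {0..1}" for y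
  proof -
    let ?x = "inv f y"
    have x: "?x \<in> {0..1}" "f ?x = y" using inv_mem[OF y] by auto
    have "(inv f \<longlongrightarrow> ?x) (at (f ?x) within {0..1})"
      using cinv y x(2) by (simp add: continuous_on_def)
    then have "(inv f has_real_derivative inverse (f' ?x)) (at (f ?x) within {0..1})"
      using pos[OF x(1)] inv_mem inv_f
      by (intro has_real_derivative_inverse_within[OF df[OF x(1)]]) auto
    then show ?thesis using x(2) by simp
  qed
  have C1: "C1_on_01 g"
    if g: "\<And>x. x \<in> {0..1} \<Longrightarrow> (g has_real_derivative g' x) (at x within {0..1})"
      and cg: "continuous_on {0..1} g'" for g g'
    unfolding C1_on_01_def
  proof
    show "g differentiable_on {0..1}"
      unfolding differentiable_on_def

  proof
    fix x :: real assume "x \<in> {0..1}"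
    then have "(g has_derivative (*) (g' x)) (at x within {0..1})"
      using g by (simp add: has_field_derivative_def)
    then show "g differentiable at x within {0..1}" by (rule differentiableI)
  qed
    show "continuous_on {0..1} (D01 g)"
      by (rule continuous_on_eq[OF cg]) (use D01_eqI[OF g] in auto)
  qed
  have "continuous_on {0..1} (\<lambda>y. inverse (f' (inv f y)))"
  proof (intro continuous_on_inverse continuous_on_compose2[OF cf' cinv])
    show "\<forall>y\<in>{0..1}. f' (inv f y) \<noteq> 0" using pos inv_mem by (metis less_irrefl)
  qed (use inv_mem in auto)
  then show ?thesis
    using bij out mono C1[OF df cf'] C1[OF dinv] by (simp add: Diff1_def)
qed

lemma has_real_derivative_glue:
  fixes p q :: "real \<Rightarrow> real"
  assumes a: "0 \<le> a" "a \<le> 1" and x: "x \<in> {0..1}"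
    and p: "x \<le> a \<Longrightarrow> (p has_real_derivative p') (at x within {0..a})"
    and q: "a \<le> x \<Longrightarrow> (q has_real_derivative q') (at x within {a..1})"
    and eq: "p a = q a" "x = a \<Longrightarrow> p' = q'"
  shows "((\<lambda>y. if y \<in> {0..a} then p y else q y) has_real_derivative (if x \<le> a then p' else q'))
    (at x within {0..1})"
proof -
  let ?g = "\<lambda>y. if y \<in> {0..a} then p y else q y"
  let ?d = "if x \<le> a then p' else q'"
  have "(?g has_real_derivative ?d) (at x within {0..a})"
  proof (cases "x \<le> a")
    case True
    have "(?g has_real_derivative p') (at x within {0..a})"
      unfolding has_field_derivative_def
      by (rule has_derivative_transform[OF _ _ p[OF True, unfolded has_field_derivative_def]])
        (use True x in auto)
    then show ?thesis using True by simp
  next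
    case False
    then have "at x within {0..a} = bot"
      by (simp add: trivial_limit_within islimpt_Icc not_in_closure_trivial_limitI)
    then show ?thesis by (simp add: has_field_derivative_iff)
  qed
  moreover have "(?g has_real_derivative ?d) (at x within {a..1})"
  proof (cases "a \<le> x")
    case True
    have "(?g has_real_derivative q') (at x within {a..1})"
      unfolding has_field_derivative_def
      by (rule has_derivative_transform[OF _ _ q[OF True, unfolded has_field_derivative_def]])
        (use True x eq in auto)
    then show ?thesis using True eq by auto
  next
    case False
    then have "at x within {a..1} = bot"
      by (simp add: not_in_closure_trivial_limitI)
    then show ?thesis by (simp add: has_field_derivative_iff)
  qed
  moreover have "{0..1} = {0..a} \<union> {a..1}" using a by auto
  ultimately show ?thesis
    by (simp add: has_field_derivative_iff Lim_Un)
qed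

section \<open>The C1 metric\<close>

lemma C1_dist_upper:
  assumes "f \<in> Diff1" "g \<in> Diff1" "x \<in> {0..1}"
  shows "\<bar>D01 f x - D01 g x\<bar> \<le> C1_dist f g"
  using assms cSUP_upper[OF assms(3) Diff1_bdd_above[OF assms(1,2)]] by (simp add: C1_dist_def)

lemma C1_dist_least:
  assumes "f \<in> Diff1" "g \<in> Diff1" "\<And>x. x \<in> {0..1} \<Longrightarrow> \<bar>D01 f x - D01 g x\<bar> \<le> e"
  shows "C1_dist f g \<le> e"
  using assms by (auto simp: C1_dist_def intro!: cSUP_least)

text \<open>
  Both maps fix \<open>0\<close>, so their difference is at most linear in \<open>x\<close>. The factor \<open>x\<close> is what makes
  conditions on the relative displacement \<open>C\<^sup>1\<close>-open all the way down to \<open>0\<close>.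
\<close>

lemma Diff1_diff_le:
  assumes f: "f \<in> Diff1" and g: "g \<in> Diff1" and x: "x \<in> {0..1}"
  shows "\<bar>f x - g x\<bar> \<le> C1_dist f g * x"
proof (cases "x = 0")
  case False
  have "\<exists>z\<in>{0<..<x}. (f x - g x) - (f 0 - g 0) = (\<lambda>z h. (D01 f z - D01 g z) * h) z (x - 0)"
  proof (rule mvt_simple)
    fix z assume "0 \<le> z" "z \<le> x"
    then have "((\<lambda>y. f y - g y) has_real_derivative D01 f z - D01 g z) (at z within {0..x})"
      using x by (intro DERIV_diff DERIV_subset[OF Diff1_has_real_derivative[OF f]]
         DERIV_subset[OF Diff1_has_real_derivative[OF g]]) auto
    then show "((\<lambda>y. f y - g y) has_derivative (\<lambda>h. (D01 f z - D01 g z) * h)) (at z within {0..x})"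
      by (simp add: has_field_derivative_def)
  qed (use False x in auto)
  then obtain z where z: "z \<in> {0<..<x}" "f x - g x = (D01 f z - D01 g z) * x"
    using Diff1_0[OF f] Diff1_0[OF g] by auto
  then have "\<bar>f x - g x\<bar> = \<bar>D01 f z - D01 g z\<bar> * x" using x by (simp add: abs_mult)
  also have "\<dots> \<le> C1_dist f g * x"
    using C1_dist_upper[OF f g, of z] z x by (intro mult_right_mono) auto
  finally show ?thesis .
qed (use Diff1_0[OF f] Diff1_0[OF g] in simp)

lemma Diff1P_topology_eq: "Diff1P_topology = Metric_space.mtopology Diff1P C1_dist"
proof -
  interpret Submetric Diff1 C1_dist Diff1P
    using Metric_space_Diff1 by (auto simp: Submetric_def Submetric_axioms_def Diff1P_def)
  show ?thesis by (simp add: Diff1P_topology_def Diff1_topology_def mtopology_submetric)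
qed

lemma Metric_space_Diff1P: "Metric_space Diff1P C1_dist"
  by (rule Metric_space.subspace[OF Metric_space_Diff1]) (auto simp: Diff1P_def)

lemma openin_Diff1P_topology:
  "openin Diff1P_topology U \<longleftrightarrow> U \<subseteq> Diff1P
     \<and> (\<forall>f\<in>U. \<exists>r>0. \<forall>g\<in>Diff1P. C1_dist f g < r \<longrightarrow> g \<in> U)"
proof -
  interpret Metric_space Diff1P C1_dist by (rule Metric_space_Diff1P)
  have "mball f r \<subseteq> U \<longleftrightarrow> (\<forall>g\<in>Diff1P. C1_dist f g < r \<longrightarrow> g \<in> U)" if "f \<in> Diff1P" for f r
    using that by auto
  then show ?thesis
    unfolding Diff1P_topology_eq openin_mtopology Ball_def by (simp add: subset_iff cong: conj_cong)
qed

lemma closure_of_Diff1P_topology: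
  "Diff1P_topology closure_of U
     = {f \<in> Diff1P. \<forall>r>0. \<exists>g\<in>U. g \<in> Diff1P \<and> C1_dist f g < r}"
  unfolding Diff1P_topology_eq Metric_space.metric_closure_of[OF Metric_space_Diff1P]
    Metric_space.mball_def[OF Metric_space_Diff1P]
  by auto


section \<open>Peaks of the relative displacement\<close>

text \<open>
  At the scale \<open>x \<le> 1 / n\<close> the relative displacement is, in absolute value, at least \<open>2 * c\<close>,
  and on the whole window \<open>(0, n * x]\<close> it is at most \<open>3 * c\<close>. The margin \<open>e\<close> turns both bounds
  into strict ones that hold uniformly over the window, which makes the condition open.
\<close>

definition peak_set :: "nat \<Rightarrow> (real \<Rightarrow> real) set" where
  "peak_set n = {f \<in> Diff1P. \<exists>x c e. 0 < x \<and> real n * x \<le> 1 \<and> 0 < e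
     \<and> (2 * c + e) * x \<le> \<bar>f x - x\<bar>
     \<and> (\<forall>y. 0 < y \<and> y \<le> real n * x \<longrightarrow> \<bar>f y - y\<bar> \<le> (3 * c - e) * y)}"

lemma openin_peak_set:
  assumes "0 < n"
  shows "openin Diff1P_topology (peak_set n)"
  unfolding openin_Diff1P_topology
proof (intro conjI ballI)
  show "peak_set n \<subseteq> Diff1P" by (auto simp: peak_set_def)
  fix f assume "f \<in> peak_set n"
  then obtain x c e where f: "f \<in> Diff1P" and x: "0 < x" "real n * x \<le> 1" and "0 < e"
    and lo: "(2 * c + e) * x \<le> \<bar>f x - x\<bar>"
    and hi: "\<And>y. 0 < y \<Longrightarrow> y \<le> real n * x \<Longrightarrow> \<bar>f y - y\<bar> \<le> (3 * c - e) * y"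
    unfolding peak_set_def by blast
  have nx: "x \<le> real n * x" using \<open>0 < n\<close> x by simp
  have "g \<in> peak_set n" if g: "g \<in> Diff1P" and d: "C1_dist f g < e / 2" for g
  proof -
    have close: "\<bar>f y - g y\<bar> \<le> e / 2 * y" if "0 < y" "y \<le> 1" for y
    proof -
      have "\<bar>f y - g y\<bar> \<le> C1_dist f g * y"
        using f g that by (intro Diff1_diff_le) (auto simp: Diff1P_def)
      also have "\<dots> \<le> e / 2 * y" using d that by (intro mult_right_mono) auto
      finally show ?thesis .
    qed
    have "(2 * c + e / 2) * x \<le> \<bar>g x - x\<bar>"
    proof -
      have "(2 * c + e / 2) * x = (2 * c + e) * x - e / 2 * x" by (simp add: algebra_simps)
      moreover have "\<bar>f x - g x\<bar> \<le> e / 2 * x" using close[of x] x nx by simp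
      ultimately show ?thesis using lo by linarith
    qed
    moreover have "\<bar>g y - y\<bar> \<le> (3 * c - e / 2) * y" if "0 < y" "y \<le> real n * x" for y
    proof -
      have "(3 * c - e / 2) * y = (3 * c - e) * y + e / 2 * y" by (simp add: algebra_simps)
      moreover have "\<bar>f y - g y\<bar> \<le> e / 2 * y" using close[of y] x that by simp
      ultimately show ?thesis using hi[OF that] by linarith
    qed
    ultimately show ?thesis
      using g x \<open>0 < e\<close> unfolding peak_set_def
      by (intro CollectI conjI exI[of _ x] exI[of _ c] exI[of _ "e/2"]) auto
  qed
  then show "\<exists>r>0. \<forall>g\<in>Diff1P. C1_dist f g < r \<longrightarrow> g \<in> peak_set n"
    using \<open>0 < e\<close> by (intro exI[of _ "e/2"]) auto
qed

section \<open>Peaks obstruct the conjugacy\<close>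

lemma Diff1_funpow_mem:
  assumes "f \<in> Diff1" "x \<in> {0..1}"
  shows "(f ^^ m) x \<in> {0..1}"
proof (induction m)
  case (Suc m)
  from Diff1_mem[OF assms(1) this] show ?case by simp
qed (use assms(2) in simp)

text \<open>
  Orbits are monotone, so later iterates only move further away; the exponent \<open>k\<close> may therefore
  be replaced by \<open>2\<close>.
\<close>

lemma Diff1_funpow_displacement:
  assumes f: "f \<in> Diff1" and x: "x \<in> {0..1}" and "2 \<le> k"
  shows "\<bar>f (f x) - x\<bar> \<le> \<bar>(f ^^ k) x - x\<bar>"
proof -
  obtain m where k: "k = m + 2" using le_Suc_ex[OF \<open>2 \<le> k\<close>] by (metis add.commute)
  have mem: "(f ^^ j) x \<in> {0..1}" for j by (rule Diff1_funpow_mem[OF f x])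
  have fx: "f x \<in> {0..1}" "f (f x) \<in> {0..1}" "f (f (f x)) \<in> {0..1}"
    by (intro Diff1_mem[OF f] x)+
  show ?thesis
  proof (cases "x \<le> f x")
    case True
    have s: "f x \<le> f (f x)" "f (f x) \<le> f (f (f x))"
      using Diff1_le[OF f, of x "f x"] Diff1_le[OF f, of "f x" "f (f x)"] True x fx by auto
    have "f (f x) \<le> (f ^^ (m + 2)) x"
    proof (induction m)
      case (Suc m)
      have "f (f (f x)) \<le> f ((f ^^ (m + 2)) x)"
        using Suc fx mem[of "m + 2"] by (intro Diff1_le[OF f]) auto
      then show ?case using s by simp
    qed (simp add: numeral_2_eq_2)
    then show ?thesis using True s k by simp
  next
    case False
    have s: "f (f x) \<le> f x" "f (f (f x)) \<le> f (f x)"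
      using Diff1_le[OF f, of "f x" x] Diff1_le[OF f, of "f (f x)" "f x"] False x fx by auto
    have "(f ^^ (m + 2)) x \<le> f (f x)"
    proof (induction m)
      case (Suc m)
      have "f ((f ^^ (m + 2)) x) \<le> f (f (f x))"
        using Suc fx mem[of "m + 2"] by (intro Diff1_le[OF f]) auto
      then show ?case using s by simp
    qed (simp add: numeral_2_eq_2)
    then show ?thesis using False s k by simp
  qed
qed

text \<open>
  The constants only have to be good enough to separate the factor \<open>k \<ge> 2\<close> from \<open>3/2\<close>: two
  steps of \<open>f\<close> move \<open>x\<close> by at least \<open>7/4\<close> of one displacement, and the values of \<open>h'\<close> near \<open>0\<close>
  differ by a factor of at most \<open>7/6\<close>, so the relative displacement grows by at least
  \<open>7/4 * 6/7 = 3/2\<close> from \<open>x\<close> to \<open>inv h x\<close>.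
\<close>

lemma peaks_obstruct_conjugacy:
  assumes f: "\<And>n. f \<in> peak_set (Suc n)" and h: "h \<in> Diff1" and k: "2 \<le> k"
    and conj: "h \<circ> f \<circ> inv h = f ^^ k"
  shows False
proof -
  have fP: "f \<in> Diff1P" using f by (auto simp: peak_set_def)
  then have fD: "f \<in> Diff1" by (simp add: Diff1P_def)
  have f0: "D01 f 0 = 1" using fP Diff1_0[OF fD] by (simp add: Diff1P_def)
  define l where "l = D01 h 0"
  have l: "0 < l" unfolding l_def by (rule Diff1_D01_pos[OF h]) simp
  obtain r1 where r1: "0 < r1" "r1 \<le> 1" "\<And>z. 0 \<le> z \<Longrightarrow> z \<le> r1 \<Longrightarrow> \<bar>D01 f z - 1\<bar> \<le> 1/4"
    using Diff1_D01_near_0[OF fD, of "1/4"] f0 by auto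
  obtain r2 where r2: "0 < r2" "r2 \<le> 1" "\<And>z. 0 \<le> z \<Longrightarrow> z \<le> r2 \<Longrightarrow> \<bar>D01 h z - l\<bar> \<le> l/13"
    using Diff1_D01_near_0[OF h, of "l/13"] l unfolding l_def by auto
  define r where "r = min r1 r2"
  have r: "0 < r" "r \<le> 1" using r1 r2 by (auto simp: r_def)
  have Dh: "12/13 * l \<le> D01 h z \<and> D01 h z \<le> 14/13 * l" if "0 \<le> z" "z \<le> r" for z
  proof -
    have "\<bar>D01 h z - l\<bar> \<le> l/13" using r2(3)[of z] that by (simp add: r_def)
    then show ?thesis by linarith
  qed
  have lip: "\<bar>(f v - v) - (f u - u)\<bar> \<le> 1/4 * \<bar>v - u\<bar>" if "0 \<le> u" "u \<le> r" "0 \<le> v" "v \<le> r" for u v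
    by (rule Diff1_displacement_lipschitz[OF fD r(2)]) (use r1 that in \<open>auto simp: r_def\<close>)
  have hr: "0 < h (r/2)" using Diff1_less[OF h, of 0 "r/2"] Diff1_0[OF h] r by simp
  \<comment> \<open>The first bound puts \<open>inv h x\<close> into the window \<open>(0, N * x]\<close>; the other two put it and \<open>x\<close>
    into \<open>(0, r / 2)\<close>, from where one application of \<open>f\<close> does not leave \<open>[0, r]\<close>.\<close>
  obtain n where n: "max (2 / l) (max (1 / h (r/2)) (2 / r)) < real n"
    using reals_Archimedean2 by blast
  define N where "N = real (Suc n)"
  have N: "2 / l < N" "1 / h (r/2) < N" "2 / r < N" "0 < N" using n by (auto simp: N_def)
  obtain x c e where x: "0 < x" "N * x \<le> 1" and "0 < e"
    and lo: "(2 * c + e) * x \<le> \<bar>f x - x\<bar>"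
    and hi: "\<And>y. 0 < y \<Longrightarrow> y \<le> N * x \<Longrightarrow> \<bar>f y - y\<bar> \<le> (3 * c - e) * y"
    using f[of n] unfolding peak_set_def N_def by blast
  have "x \<le> 1 / N" using x N by (simp add: field_simps)
  also have "1 / N < h (r/2)" using N hr by (simp add: field_simps)
  finally have xh: "x < h (r/2)" .
  have "x \<le> 1 / N" using x N by (simp add: field_simps)
  also have "1 / N < r / 2" using N r by (simp add: field_simps)
  finally have xr: "x < r / 2" .
  then have x01: "x \<in> {0..1}" using x r by auto
  define y where "y = inv h x"
  have hy: "h y = x" using Diff1_bij[OF h] by (simp add: y_def bij_is_surj surj_f_inv_f)
  have y01: "y \<in> {0..1}" unfolding y_def by (rule Diff1_inv_mem[OF h x01])
  have y0: "0 < y" using hy Diff1_0[OF h] x y01 by (cases "y = 0") auto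
  have yr: "y < r / 2" using Diff1_le[OF h, of "r/2" y] xh hy y01 r by fastforce
  have f0': "f 0 = 0" by (rule Diff1_0[OF fD])
  have f_le: "f u \<le> r" if "0 < u" "u < r / 2" for u
  proof -
    have "\<bar>f u - u\<bar> \<le> 1/4 * u" using lip[of 0 u] that r f0' by simp
    then show ?thesis using that by linarith
  qed
  have fx: "0 \<le> f x" "f x \<le> r" using f_le x xr Diff1_mem[OF fD x01] by auto
  have fy: "0 \<le> f y" "f y \<le> r" using f_le y0 yr Diff1_mem[OF fD y01] by auto
  have xy: "12/13 * l * y \<le> x"
  proof -
    obtain z where z: "0 \<le> z" "z \<le> r" "h y - h 0 = D01 h z * (y - 0)"
      using Diff1_mean_value[OF h, of 0 y r] y0 yr r by auto
    then have "x = D01 h z * y" using hy Diff1_0[OF h] by simp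
    then show ?thesis using Dh[OF z(1,2)] y0 by simp
  qed
  have yN: "y \<le> N * x"
  proof -
    have "2 < N * l" using N l by (simp add: field_simps)
    then have "N * (12/13 * l * y) \<le> N * x" using xy N by (intro mult_left_mono) auto
    moreover have "2 * y \<le> N * l * y" using \<open>2 < N * l\<close> y0 by simp
    moreover have "0 < N * x" using N x by simp
    ultimately show ?thesis by (simp add: algebra_simps)
  qed
  have hfy: "h (f y) = (f ^^ k) x"
    using fun_cong[OF conj, of x] by (simp add: y_def)
  obtain z where z: "0 \<le> z" "z \<le> r" "h (f y) - h y = D01 h z * (f y - y)"
    using Diff1_mean_value[OF h, of y "f y" r] y0 yr r fy by auto
  have "\<bar>(f ^^ k) x - x\<bar> = D01 h z * \<bar>f y - y\<bar>"
    using z hfy hy Dh[OF z(1,2)] l by (simp add: abs_mult)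
  also have "\<dots> \<le> 14/13 * l * ((3 * c - e) * y)"
    using Dh[OF z(1,2)] hi[OF y0 yN] l by (intro mult_mono) auto
  finally have up: "\<bar>(f ^^ k) x - x\<bar> \<le> 7/6 * (3 * c - e) * (12/13 * l * y)"
    by (simp add: algebra_simps)
  have "0 \<le> (3 * c - e) * y" using hi[OF y0 yN] by linarith
  then have "0 \<le> 3 * c - e" using y0 by (simp add: zero_le_mult_iff)
  then have "7/6 * (3 * c - e) * (12/13 * l * y) \<le> 7/6 * (3 * c - e) * x"
    using xy by (intro mult_left_mono) auto
  with up have up: "\<bar>(f ^^ k) x - x\<bar> \<le> 7/6 * (3 * c - e) * x" by linarith
  have "\<bar>(f (f x) - f x) - (f x - x)\<bar> \<le> 1/4 * \<bar>f x - x\<bar>"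
    using lip[of x "f x"] x xr fx r by simp
  moreover have "7/4 * \<bar>q\<bar> \<le> \<bar>p + q\<bar>" if "\<bar>p - q\<bar> \<le> 1/4 * \<bar>q\<bar>" for p q :: real
    using that by (auto simp: abs_if split: if_splits)
  ultimately have "7/4 * \<bar>f x - x\<bar> \<le> \<bar>(f (f x) - f x) + (f x - x)\<bar>" by blast
  then have "7/4 * \<bar>f x - x\<bar> \<le> \<bar>f (f x) - x\<bar>" by simp
  also have "\<dots> \<le> \<bar>(f ^^ k) x - x\<bar>" by (rule Diff1_funpow_displacement[OF fD x01 k])
  also note up
  finally have "7/4 * \<bar>f x - x\<bar> \<le> 7/6 * (3 * c - e) * x" .
  moreover have "7/4 * ((2 * c + e) * x) \<le> 7/4 * \<bar>f x - x\<bar>" using lo by (intro mult_left_mono) auto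
  ultimately have "7/4 * ((2 * c + e) * x) \<le> 7/6 * (3 * c - e) * x" by (rule order_trans[rotated])
  then have "e * x \<le> 0" by (simp add: algebra_simps)
  then show False using \<open>0 < e\<close> x by (simp add: mult_le_0_iff)
qed

section \<open>Peaks can be created by small perturbations\<close>

text \<open>
  The factor \<open>c * y\<^sup>2 / (y + s)\<close> is tangent to \<open>0\<close> at \<open>0\<close> but close to the linear function \<open>c * y\<close>
  for \<open>y\<close> much larger than \<open>s\<close>, and its derivative lies between \<open>0\<close> and \<open>c\<close> whatever \<open>s\<close> is.
  Hence the slope relative to \<open>0\<close> gets close to its supremum \<open>c\<close> at scales as small as desired,
  at a \<open>C\<^sup>1\<close> cost of order \<open>c\<close>. The factor \<open>(1 - y / a)\<^sup>2\<close> makes the function and its derivative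
  vanish at \<open>a\<close>.
\<close>

definition bump :: "real \<Rightarrow> real \<Rightarrow> real \<Rightarrow> real \<Rightarrow> real" where
  "bump c s a y = c * (y\<^sup>2 / (y + s) * (1 - y / a)\<^sup>2)"

definition bump_deriv :: "real \<Rightarrow> real \<Rightarrow> real \<Rightarrow> real \<Rightarrow> real" where
  "bump_deriv c s a y =
     c * ((1 - (s / (y + s))\<^sup>2) * (1 - y / a)\<^sup>2 - 2 / a * (y\<^sup>2 / (y + s)) * (1 - y / a))"

lemma has_real_derivative_bump:
  assumes "0 < s" "0 \<le> y" "0 < a"
  shows "(bump c s a has_real_derivative bump_deriv c s a y) (at y within S)"
proof -
  have "y + s \<noteq> 0" using assms by simp
  have q: "((\<lambda>y. y\<^sup>2 / (y + s)) has_real_derivative 1 - (s / (y + s))\<^sup>2) (at y within S)"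
  proof -
    have "(2 * y * (y + s) - y\<^sup>2) / ((y + s) * (y + s)) = 1 - (s / (y + s))\<^sup>2"
    proof -
      define w where "w = y + s"
      have s_eq: "s = w - y" and "w \<noteq> 0" using \<open>y + s \<noteq> 0\<close> by (auto simp: w_def)
      show ?thesis unfolding s_eq using \<open>w \<noteq> 0\<close> by (simp add: field_simps power2_eq_square)
    qed
    moreover have "((\<lambda>y. y\<^sup>2 / (y + s)) has_real_derivative
        (2 * y * (y + s) - y\<^sup>2) / ((y + s) * (y + s))) (at y within S)"
      using \<open>y + s \<noteq> 0\<close> by (auto intro!: derivative_eq_intros)
    ultimately show ?thesis by simp
  qed
  have p: "((\<lambda>y. (1 - y / a)\<^sup>2) has_real_derivative - (2 / a * (1 - y / a))) (at y within S)"
  proof -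
    have "((\<lambda>y. 1 - y / a) has_real_derivative - (1 / a)) (at y within S)"
      using \<open>0 < a\<close> by (auto intro!: derivative_eq_intros)
    from DERIV_power[OF this, of 2] show ?thesis by simp
  qed
  show ?thesis
    unfolding bump_def bump_deriv_def
  proof (rule DERIV_cong[OF DERIV_cmult[OF DERIV_mult[OF q p]]])
    have "c * (A * Q + - (k * T) * P) = c * (A * Q - k * P * T)" for A Q P T k :: real
      by (simp add: algebra_simps)
    then show "c * ((1 - (s / (y + s))\<^sup>2) * (1 - y / a)\<^sup>2 + - (2 / a * (1 - y / a)) * (y\<^sup>2 / (y + s)))
      = c * ((1 - (s / (y + s))\<^sup>2) * (1 - y / a)\<^sup>2 - 2 / a * (y\<^sup>2 / (y + s)) * (1 - y / a))" .
  qed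
qed

lemma continuous_on_bump_deriv:
  assumes "0 < s" "0 < a"
  shows "continuous_on {0..} (bump_deriv c s a)"
  unfolding bump_deriv_def using assms by (intro continuous_intros) auto

lemma abs_bump_deriv_le:
  assumes "0 < s" "0 \<le> y" "y \<le> a" "0 < a" "0 < c"
  shows "\<bar>bump_deriv c s a y\<bar> \<le> 2 * c"
proof -
  define A where "A = (1 - (s / (y + s))\<^sup>2) * (1 - y / a)\<^sup>2"
  define B where "B = 2 / a * (y\<^sup>2 / (y + s)) * (1 - y / a)"
  have t: "0 \<le> 1 - y / a" "1 - y / a \<le> 1" using assms by auto
  have "0 \<le> (s / (y + s))\<^sup>2" "(s / (y + s))\<^sup>2 \<le> 1"
    using assms by (auto intro!: power_le_one)
  then have A: "0 \<le> A" "A \<le> 1"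
    unfolding A_def using t by (auto intro!: mult_le_one power_le_one)
  have "y\<^sup>2 / (y + s) \<le> a"
    using assms by (simp add: divide_le_eq power2_eq_square mult_mono add_increasing2)
  then have "2 / a * (y\<^sup>2 / (y + s)) \<le> 2 / a * a"
    using assms by (intro mult_left_mono) auto
  then have "2 / a * (y\<^sup>2 / (y + s)) \<le> 2"
    using assms by simp
  moreover have "0 \<le> 2 / a * (y\<^sup>2 / (y + s))" using assms by auto
  ultimately have B: "0 \<le> B" "B \<le> 2 * 1"
    unfolding B_def using t by (blast intro: mult_nonneg_nonneg, intro mult_mono) auto
  have "\<bar>A - B\<bar> \<le> 2" using A B by auto
  then have "c * \<bar>A - B\<bar> \<le> c * 2" using assms by (intro mult_left_mono) auto
  then show ?thesis using assms by (simp add: bump_deriv_def A_def B_def abs_mult)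
qed

lemma bump_pos:
  assumes "0 < s" "0 < y" "y < a" "0 < c"
  shows "0 < bump c s a y"
  using assms by (auto simp: bump_def intro!: mult_pos_pos divide_pos_pos)

lemma bump_le:
  assumes "0 < s" "0 \<le> y" "y \<le> a" "0 < a" "0 < c"
  shows "bump c s a y \<le> c * y"
proof -
  have "y\<^sup>2 / (y + s) \<le> y" using assms by (simp add: divide_le_eq power2_eq_square algebra_simps)
  moreover have "(1 - y / a)\<^sup>2 \<le> 1" using assms by (intro power_le_one) auto
  ultimately have "y\<^sup>2 / (y + s) * (1 - y / a)\<^sup>2 \<le> y * 1"
    using assms by (intro mult_mono) auto
  then have "c * (y\<^sup>2 / (y + s) * (1 - y / a)\<^sup>2) \<le> c * (y * 1)"
    using assms by (intro mult_left_mono) auto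
  then show ?thesis by (simp only: bump_def mult_1_right)
qed

lemma bump_peak:
  assumes "0 < x" "x \<le> a / 20" "0 < c"
  shows "0.82 * c * x \<le> bump c (x/10) a x"
proof -
  have "0 < a" using assms by simp
  then have "0.95 \<le> 1 - x / a" using assms by (simp add: field_simps)
  then have "0.95\<^sup>2 \<le> (1 - x / a)\<^sup>2" by (intro power_mono) auto
  then have "10/11 * x * 0.95\<^sup>2 \<le> 10/11 * x * (1 - x / a)\<^sup>2"
    using assms by (intro mult_left_mono) auto
  moreover have "x\<^sup>2 / (x + x/10) = 10/11 * x"
    using assms by (simp add: power2_eq_square field_simps)
  ultimately have "10/11 * x * 0.95\<^sup>2 \<le> x\<^sup>2 / (x + x/10) * (1 - x / a)\<^sup>2"
    by (simp only:)
  moreover have "0.82 * x \<le> 10/11 * x * 0.95\<^sup>2" using assms by (simp add: power2_eq_square)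
  ultimately have "0.82 * x \<le> x\<^sup>2 / (x + x/10) * (1 - x / a)\<^sup>2" by linarith
  then have "c * (0.82 * x) \<le> bump c (x/10) a x"
    unfolding bump_def using assms by (intro mult_left_mono) auto
  then show ?thesis by (simp add: algebra_simps)
qed

lemma id_in_Diff1P: "(\<lambda>x. x) \<in> Diff1P"
proof -
  have "D01 (\<lambda>x. x) x = 1" if "x \<in> {0..1}" for x
    by (rule D01_eqI[OF DERIV_ident that])
  moreover have "(\<lambda>x. x) \<in> Diff1"
    by (rule Diff1I[where f' = "\<lambda>_. 1"]) auto
  ultimately show ?thesis by (auto simp: Diff1P_def)
qed

text \<open>
  If \<open>f\<close> has a fixed point \<open>a\<close> close to \<open>0\<close>, then \<open>f\<close> may be replaced by the identity on \<open>[0, a]\<close>: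
  the two agree to first order at \<open>a\<close> because \<open>a\<close> is parabolic. Otherwise the displacement of \<open>f\<close>
  has no zero near \<open>0\<close> other than \<open>0\<close> itself, hence has a constant sign there, and \<open>f\<close> itself
  serves.
\<close>

lemma signed_replacement:
  assumes f: "f \<in> Diff1P" and e: "0 < e"
  obtains a b sg where "0 < a" "a < 1" "b \<in> Diff1P" "b a = f a" "D01 b a = D01 f a"
    "sg = 1 \<or> sg = -1" "\<And>y. 0 \<le> y \<Longrightarrow> y \<le> a \<Longrightarrow> 0 \<le> sg * (b y - y)"
    "\<And>y. 0 \<le> y \<Longrightarrow> y \<le> a \<Longrightarrow> \<bar>D01 b y - 1\<bar> \<le> e"
    "\<And>y. 0 \<le> y \<Longrightarrow> y \<le> a \<Longrightarrow> \<bar>D01 f y - 1\<bar> \<le> e"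
proof -
  have fD: "f \<in> Diff1" using f by (simp add: Diff1P_def)
  have "D01 f 0 = 1" using f Diff1_0[OF fD] by (simp add: Diff1P_def)
  then obtain r where r: "0 < r" "r \<le> 1" "\<And>z. 0 \<le> z \<Longrightarrow> z \<le> r \<Longrightarrow> \<bar>D01 f z - 1\<bar> \<le> e"
    using Diff1_D01_near_0[OF fD e] by metis
  show ?thesis
  proof (cases "\<exists>a. 0 < a \<and> a < r \<and> f a = a")
    case True
    then obtain a where a: "0 < a" "a < r" "f a = a" by blast
    have id: "D01 (\<lambda>x. x) y = 1" if "0 \<le> y" "y \<le> a" for y
      by (rule D01_eqI[OF DERIV_ident]) (use that a r in auto)
    have Dfa: "D01 f a = 1" using f a r by (auto simp: Diff1P_def)
    show ?thesis
    proof (rule that[of a "\<lambda>x. x" 1])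
      show "D01 (\<lambda>x. x) a = D01 f a" using id[of a] Dfa a by simp
      show "\<bar>D01 (\<lambda>x. x) y - 1\<bar> \<le> e" if "0 \<le> y" "y \<le> a" for y using id[OF that] e by simp
      show "\<bar>D01 f y - 1\<bar> \<le> e" if "0 \<le> y" "y \<le> a" for y using r(3)[of y] that a by linarith
      show "(\<lambda>x. x) \<in> Diff1P" by (rule id_in_Diff1P)
      show "0 < a" "a < 1" using a r by linarith+
      show "a = f a" using a by simp
    qed simp_all
  next
    case False
    then have no_fix: "f y \<noteq> y" if "0 < y" "y < r" for y using that by blast
    define a where "a = r / 2"
    have a: "0 < a" "a < r" "a < 1" using r by (auto simp: a_def)
    have cont: "continuous_on {0..1} (\<lambda>y. f y - y)"
      using DERIV_continuous_on[OF Diff1_has_real_derivative[OF fD]]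
      by (intro continuous_intros) auto
    have same: False if uv: "0 < u" "u \<le> a" "0 < v" "v \<le> a" and lt: "f u < u" "v < f v" for u v
    proof -
      have cuv: "continuous_on {p..q} (\<lambda>y. f y - y)" if "0 < p" "q \<le> a" for p q
        by (rule continuous_on_subset[OF cont]) (use that a in auto)
      obtain w where w: "0 < w" "w \<le> a" "f w - w = 0"
      proof (cases "u \<le> v")
        case True
        have "\<exists>w\<ge>u. w \<le> v \<and> f w - w = 0"
          by (rule IVT'[OF _ _ True cuv]) (use uv lt in simp_all)
        then obtain w where "u \<le> w" "w \<le> v" "f w - w = 0" by blast
        then show thesis using that[of w] uv by linarith
      next
        case False
        have "\<exists>w\<ge>v. w \<le> u \<and> f w - w = 0"
          by (rule IVT2'[OF _ _ _ cuv]) (use uv lt False in simp_all)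
        then obtain w where "v \<le> w" "w \<le> u" "f w - w = 0" by blast
        then show thesis using that[of w] uv by linarith
      qed
      then show False using no_fix[of w] a by simp
    qed
    define sg where "sg = (if a < f a then 1 else - 1 :: real)"
    have sgn: "0 \<le> sg * (f y - y)" if y: "0 \<le> y" "y \<le> a" for y
    proof (cases "y = 0")
      case True
      then show ?thesis using Diff1_0[OF fD] by simp
    next
      case False
      then have "0 < y" using y by simp
      show ?thesis
      proof (cases "a < f a")
        case True
        then have "\<not> f y < y" using same[of y a] \<open>0 < y\<close> y a by blast
        then show ?thesis using True by (simp add: sg_def)
      next
        case False
        then have "f a < a" using no_fix[of a] a by linarith
        then have "\<not> y < f y" using same[of a y] \<open>0 < y\<close> y a by blast
        then show ?thesis using False by (simp add: sg_def)
      qed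
    qed
    have Df: "\<bar>D01 f y - 1\<bar> \<le> e" if "0 \<le> y" "y \<le> a" for y using r(3)[of y] that a by linarith
    show ?thesis
      by (rule that[of a f sg, OF a(1,3) f refl refl _ sgn Df Df]) (simp_all add: sg_def)
  qed
qed

text \<open>
  On \<open>[0, a]\<close> the new map is the replacement \<open>b\<close> plus a bump of the sign of its displacement. No
  fixed point arises in the interior of \<open>[0, a]\<close>, where the displacement is now nonzero, and at
  \<open>0\<close> and \<open>a\<close> the bump does not change the derivative. Near \<open>0\<close> the relative displacement of \<open>b\<close>
  is negligible compared with \<open>c\<close>, so that of the new map is at most \<open>1.05 * c\<close> on the
  window, and at least \<open>0.82 * c\<close> at \<open>x\<close>.
\<close>

lemma peak_set_dense:
  assumes f: "f \<in> Diff1P" and e0: "0 < e0" and n: "0 < n"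
  obtains g where "g \<in> peak_set n" "C1_dist f g < e0"
proof -
  define c where "c = min (e0 / 10) (1 / 10)"
  have c: "0 < c" "c \<le> 1 / 10" "c \<le> e0 / 10" using e0 by (auto simp: c_def)
  have fD: "f \<in> Diff1" using f by (simp add: Diff1P_def)
  obtain a b sg where a: "0 < a" "a < 1" and b: "b \<in> Diff1P" "b a = f a" "D01 b a = D01 f a"
    and sg: "sg = 1 \<or> sg = -1" and sgn: "\<And>y. 0 \<le> y \<Longrightarrow> y \<le> a \<Longrightarrow> 0 \<le> sg * (b y - y)"
    and Db: "\<And>y. 0 \<le> y \<Longrightarrow> y \<le> a \<Longrightarrow> \<bar>D01 b y - 1\<bar> \<le> c"
    and Df: "\<And>y. 0 \<le> y \<Longrightarrow> y \<le> a \<Longrightarrow> \<bar>D01 f y - 1\<bar> \<le> c"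
    by (rule signed_replacement[OF f c(1)]) (rule that; assumption)
  have bD: "b \<in> Diff1" using b by (simp add: Diff1P_def)
  have b0: "b 0 = 0" by (rule Diff1_0[OF bD])
  have "D01 b 0 = 1" using b b0 by (simp add: Diff1P_def)
  then obtain r where r: "0 < r" "r \<le> 1" "\<And>z. 0 \<le> z \<Longrightarrow> z \<le> r \<Longrightarrow> \<bar>D01 b z - 1\<bar> \<le> c / 20"
    using Diff1_D01_near_0[OF bD, of "c/20"] c by auto
  \<comment> \<open>The window \<open>(0, n * x]\<close> ends well before \<open>r\<close>, where \<open>b\<close> stops being close to the identity,
    and before \<open>a\<close>, so that the cut-off factor of the bump is close to \<open>1\<close> at \<open>x\<close>.\<close>
  define x where "x = min r a / (20 * real n)"
  have x0: "0 < x" using r a n by (simp add: x_def)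
  have nx: "real n * x = min r a / 20" using n by (simp add: x_def)
  have "x \<le> real n * x" using n x0 by simp
  then have xa: "x \<le> a / 20" using nx by simp
  define s where "s = x / 10"
  have s: "0 < s" using x0 by (simp add: s_def)
  define g where "g = (\<lambda>y. if y \<in> {0..a} then b y + sg * bump c s a y else f y)"
  define g' where "g' = (\<lambda>y. if y \<le> a then D01 b y + sg * bump_deriv c s a y else D01 f y)"
  have bump_a: "bump c s a a = 0" "bump_deriv c s a a = 0" using a by (simp_all add: bump_def bump_deriv_def)
  have bump_0: "bump c s a 0 = 0" "bump_deriv c s a 0 = 0" using s by (simp_all add: bump_def bump_deriv_def)
  have dg: "(g has_real_derivative g' y) (at y within {0..1})" if y: "y \<in> {0..1}" for y
    unfolding g_def g'_def
  proof (rule has_real_derivative_glue)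
    assume "y \<le> a"
    have "(b has_real_derivative D01 b y) (at y within {0..a})"
      by (rule DERIV_subset[OF Diff1_has_real_derivative[OF bD y]]) (use a in auto)
    then show "((\<lambda>y. b y + sg * bump c s a y) has_real_derivative
        D01 b y + sg * bump_deriv c s a y) (at y within {0..a})"
      using y a s by (intro DERIV_add DERIV_cmult has_real_derivative_bump) auto
  next
    show "(f has_real_derivative D01 f y) (at y within {a..1})"
      by (rule DERIV_subset[OF Diff1_has_real_derivative[OF fD y]]) (use a in auto)
  qed (use a b y bump_a in auto)
  have cg': "continuous_on {0..1} g'"
    unfolding g'_def
  proof (rule continuous_on_cases_1)
    show "continuous_on {t \<in> {0..1}. t \<le> a} (\<lambda>y. D01 b y + sg * bump_deriv c s a y)"
      by (intro continuous_intros continuous_on_subset[OF Diff1_continuous_on_D01[OF bD]]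
          continuous_on_subset[OF continuous_on_bump_deriv[OF s a(1)]]) auto
    show "continuous_on {t \<in> {0..1}. a \<le> t} (D01 f)"
      by (rule continuous_on_subset[OF Diff1_continuous_on_D01[OF fD]]) auto
  qed (use b bump_a in simp)
  have bd: "\<bar>sg * bump_deriv c s a y\<bar> \<le> 2 * c" if "0 \<le> y" "y \<le> a" for y
    using abs_bump_deriv_le[OF s that a(1) c(1)] sg by auto
  have gD: "g \<in> Diff1"
  proof (rule Diff1I[OF dg cg'])
    fix y :: real assume y: "y \<in> {0..1}"
    show "0 < g' y"
      using bd[of y] Db[of y] c y Diff1_D01_pos[OF fD y] by (auto simp: g'_def)
  next
    show "g 0 = 0" "g 1 = 1" using a b0 bump_0 Diff1_1[OF fD] by (auto simp: g_def)
    show "g y = y" if "y \<notin> {0..1}" for y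
      using that a fD by (auto simp: g_def Diff1_def)
  qed auto
  have Dg: "D01 g y = g' y" if "y \<in> {0..1}" for y
    by (rule D01_eqI[OF dg[OF that] that])
  have disp: "\<bar>g y - y\<bar> = \<bar>b y - y\<bar> + bump c s a y" if "0 < y" "y < a" for y
    using sgn[of y] sg bump_pos[OF s that c(1)] that by (auto simp: g_def)
  have gP: "g \<in> Diff1P"
  proof -
    have "g' y = 1" if y: "y \<in> {0..1}" "g y = y" for y
    proof -
      consider "y = 0" | "0 < y" "y < a" | "a \<le> y" using y by fastforce
      then show ?thesis
      proof cases
        case 1
        then show ?thesis using \<open>D01 b 0 = 1\<close> a bump_0 by (simp add: g'_def)
      next
        case 2
        then show ?thesis using disp[OF 2] bump_pos[OF s 2 c(1)] y by simp
      next
        case 3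
        then have "g y = f y" "g' y = D01 f y" using b bump_a a by (auto simp: g_def g'_def)
        then show ?thesis using f y by (auto simp: Diff1P_def)
      qed
    qed
    then show ?thesis using gD Dg by (auto simp: Diff1P_def)
  qed
  have "C1_dist f g \<le> 4 * c"
  proof (rule C1_dist_least[OF fD gD])
    fix y :: real assume y: "y \<in> {0..1}"
    show "\<bar>D01 f y - D01 g y\<bar> \<le> 4 * c"
      using Dg[OF y] bd[of y] Db[of y] Df[of y] c y by (auto simp: g'_def)
  qed
  then have dist: "C1_dist f g < e0" using c e0 by linarith
  have "g \<in> peak_set n"
  proof -
    have "\<bar>g x - x\<bar> = \<bar>b x - x\<bar> + bump c s a x" by (rule disp) (use x0 xa a in linarith)+
    moreover have "0.82 * c * x \<le> bump c s a x"
      unfolding s_def by (rule bump_peak[OF x0 xa c(1)])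
    ultimately have "0.82 * c * x \<le> \<bar>g x - x\<bar>" by linarith
    \<comment> \<open>The values \<open>0.38 * c\<close> and \<open>0.06 * c\<close> solve \<open>2 * C + e = 0.82 * c\<close> with
      \<open>3 * C - e \<ge> 1.05 * c\<close>.\<close>
    then have lo: "(2 * (0.38 * c) + 0.06 * c) * x \<le> \<bar>g x - x\<bar>" by (simp add: algebra_simps)
    have hi: "\<bar>g y - y\<bar> \<le> (3 * (0.38 * c) - 0.06 * c) * y" if "0 < y" "y \<le> real n * x" for y
    proof -
      have y: "y \<le> r" "y < a" using that nx r a by auto
      have "\<bar>b y - y\<bar> \<le> c / 20 * y"
        using Diff1_displacement_lipschitz[OF bD r(2) r(3), of 0 y] that y b0 r by simp
      moreover have "bump c s a y \<le> c * y" using bump_le[OF s, of y a c] that y a c by simp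
      moreover have "c * y \<ge> 0" using c that by simp
      ultimately show ?thesis using disp[of y] that y by (simp add: algebra_simps)
    qed
    have "real n * x \<le> 1" using nx r by simp
    then show ?thesis
      using gP x0 lo hi c unfolding peak_set_def
      by (intro CollectI conjI exI[of _ x] exI[of _ "0.38 * c"] exI[of _ "0.06 * c"]) auto
  qed
  then show ?thesis using dist that by blast
qed

theorem theorem2:
  shows "residual_in Diff1P_topology
           {f \<in> Diff1P. \<not> (\<exists>k::nat. k \<ge> 2 \<and> (\<exists>h\<in>Diff1. h \<circ> f \<circ> inv h = f ^^ k))}"
  unfolding residual_in_def topspace_Diff1P_topology
proof (intro conjI exI[of _ "\<lambda>n. peak_set (Suc n)"] allI)
  show "openin Diff1P_topology (peak_set (Suc n))" for n by (rule openin_peak_set) simp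
  show "Diff1P_topology closure_of peak_set (Suc n) = Diff1P" for n
  proof -
    have "\<exists>g\<in>peak_set (Suc n). g \<in> Diff1P \<and> C1_dist f g < r" if "f \<in> Diff1P" "0 < r" for f r
    proof -
      obtain g where "g \<in> peak_set (Suc n)" "C1_dist f g < r"
        using peak_set_dense[OF \<open>f \<in> Diff1P\<close> \<open>0 < r\<close>, of "Suc n"] by auto
      moreover from this have "g \<in> Diff1P" by (simp add: peak_set_def)
      ultimately show ?thesis by blast
    qed
    then show ?thesis unfolding closure_of_Diff1P_topology by auto
  qed
  show "(\<Inter>n. peak_set (Suc n))
      \<subseteq> {f \<in> Diff1P. \<not> (\<exists>k\<ge>2. \<exists>h\<in>Diff1. h \<circ> f \<circ> inv h = f ^^ k)}"
  proof
    fix f assume "f \<in> (\<Inter>n. peak_set (Suc n))"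
    then have f: "f \<in> peak_set (Suc n)" for n by blast
    then have "f \<in> Diff1P" by (auto simp: peak_set_def)
    then show "f \<in> {f \<in> Diff1P. \<not> (\<exists>k\<ge>2. \<exists>h\<in>Diff1. h \<circ> f \<circ> inv h = f ^^ k)}"
      using peaks_obstruct_conjugacy[OF f] by blast
  qed
qed auto

end
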